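(* Let $(X,d)$ be a complete metric space and let $\sigma\colon X\times X\times[0,1]\to X$ be a conical geodesic bicombing that has the midpoint property. Suppose that $\Sigma$ is a $\sigma$-equivariant subsemigroup of the isometry group of $X$. If there is a non-empty compact subset $K\subset X$ such that $s(K)=K$ for all $s\in\Sigma$, then there is a point $x_\star\in\overline{\mathrm{conv}_\sigma}(K)$ such that $s(x_\star)=x_\star$ for all $s\in\Sigma$.
   Context: Let $(X,d)$ be a metric space. The isometry group of $X$ consists of the distance-preserving bijections $X\to X$, with composition. A map $\sigma\colon X\times X\times[0,1]\to X$, written $\sigma_{xy}(t):=\sigma(x,y,t)$, is a conical geodesic bicombing if for all $x,y\in X$ the map $\sigma_{xy}$ is a constant speed geodesic from $x$ to $y$, that is, $\sigma_{xy}(0)=x$, $\sigma_{xy}(1)=y$ and $d(\sigma_{xy}(s),\sigma_{xy}(t))=|s-t|\,d(x,y)$ for all $s,t\in[0,1]$, and if $d(\sigma_{xy}(t),\sigma_{x'y'}(t))\le(1-t)d(x,x')+t\,d(y,y')$ for all $x,x',y,y'\in X$ and $t\in[0,1]$. It has the midpoint property if $\sigma_{xy}(\tfrac12)=\sigma_{yx}(\tfrac12)$ for all $x,y\in X$. For $A\subset X$, put $A_1:=A$, $A_{k+1}:=\{\sigma_{xy}(t):x,y\in A_k,\ t\in[0,1]\}$. The $\sigma$-convex hull of $A$ is $\mathrm{conv}_\sigma(A):=\bigcup_{k\ge1}A_k$, and $\overline{\mathrm{conv}_\sigma}(A)$ denotes its closure. An isometry $\phi\colon X\to X$ is $\sigma$-equivariant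 if $\phi\circ\sigma_{xy}=\sigma_{\phi(x)\phi(y)}$ for all $x,y\in X$. A subsemigroup $\Sigma$ of the isometry group is $\sigma$-equivariant if every element of $\Sigma$ is $\sigma$-equivariant. *)

theory Defs
  imports "HOL-Analysis.Analysis"
begin

text \<open>
  A bicombing \<open>X \<times> X \<times> [0,1] \<rightarrow> X\<close> is a curried total function
  \<open>'a \<Rightarrow> 'a \<Rightarrow> real \<Rightarrow> 'a\<close>. Its values at parameters outside \<open>{0..1}\<close> carry no meaning, and
  nothing below refers to them.
\<close>

definition constant_speed_geodesic :: "(real \<Rightarrow> 'a::metric_space) \<Rightarrow> 'a \<Rightarrow> 'a \<Rightarrow> bool" where
  "constant_speed_geodesic \<gamma> x y \<longleftrightarrow>
     \<gamma> 0 = x \<and> \<gamma> 1 = y \<and>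
     (\<forall>s\<in>{0..1}. \<forall>t\<in>{0..1}. dist (\<gamma> s) (\<gamma> t) = \<bar>s - t\<bar> * dist x y)"

definition conical_geodesic_bicombing :: "('a::metric_space \<Rightarrow> 'a \<Rightarrow> real \<Rightarrow> 'a) \<Rightarrow> bool" where
  "conical_geodesic_bicombing \<sigma> \<longleftrightarrow>
     (\<forall>x y. constant_speed_geodesic (\<sigma> x y) x y) \<and>
     (\<forall>x x' y y'. \<forall>t\<in>{0..1}.
        dist (\<sigma> x y t) (\<sigma> x' y' t) \<le> (1 - t) * dist x x' + t * dist y y')"

definition midpoint_property :: "('a \<Rightarrow> 'a \<Rightarrow> real \<Rightarrow> 'a) \<Rightarrow> bool" where
  "midpoint_property \<sigma> \<longleftrightarrow> (\<forall>x y. \<sigma> x y (1/2) = \<sigma> y x (1/2))"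

text \<open>Indexing starts at \<open>0\<close>: \<open>conv_stage \<sigma> A k\<close> is the set usually written \<open>A\<^sub>k\<^sub>+\<^sub>1\<close>.\<close>

primrec conv_stage :: "('a \<Rightarrow> 'a \<Rightarrow> real \<Rightarrow> 'a) \<Rightarrow> 'a set \<Rightarrow> nat \<Rightarrow> 'a set" where
  "conv_stage \<sigma> A 0 = A"
| "conv_stage \<sigma> A (Suc k) =
     {\<sigma> x y t | x y t. x \<in> conv_stage \<sigma> A k \<and> y \<in> conv_stage \<sigma> A k \<and> t \<in> {0..1}}"

definition sigma_convex_hull :: "('a \<Rightarrow> 'a \<Rightarrow> real \<Rightarrow> 'a) \<Rightarrow> 'a set \<Rightarrow> 'a set" where
  "sigma_convex_hull \<sigma> A = (\<Union>k. conv_stage \<sigma> A k)"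

definition isometries :: "('a::metric_space \<Rightarrow> 'a) set" where
  "isometries = {\<phi>. bij \<phi> \<and> (\<forall>x y. dist (\<phi> x) (\<phi> y) = dist x y)}"

text \<open>
  The group operation on \<open>isometries\<close> is composition. A subsemigroup is not required to contain
  the identity or inverses; the empty set is allowed.
\<close>

definition isometry_subsemigroup :: "('a::metric_space \<Rightarrow> 'a) set \<Rightarrow> bool" where
  "isometry_subsemigroup S \<longleftrightarrow> S \<subseteq> isometries \<and> (\<forall>\<phi>\<in>S. \<forall>\<psi>\<in>S. \<phi> \<circ> \<psi> \<in> S)"

definition equivariant_map :: "('a \<Rightarrow> 'a \<Rightarrow> real \<Rightarrow> 'a) \<Rightarrow> ('a \<Rightarrow> 'a) \<Rightarrow> bool" where
  "equivariant_map \<sigma> \<phi> \<longleftrightarrow> (\<forall>x y. \<forall>t\<in>{0..1}. \<phi> (\<sigma> x y t) = \<sigma> (\<phi> x) (\<phi> y) t)"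

definition equivariant_subsemigroup ::
    "('a::metric_space \<Rightarrow> 'a \<Rightarrow> real \<Rightarrow> 'a) \<Rightarrow> ('a \<Rightarrow> 'a) set \<Rightarrow> bool" where
  "equivariant_subsemigroup \<sigma> S \<longleftrightarrow> isometry_subsemigroup S \<and> (\<forall>\<phi>\<in>S. equivariant_map \<sigma> \<phi>)"

end

theory Submission
  imports Defs
begin

text \<open>
  The fixed point is an average of the compact set over its symmetries, built without a Haar measure.
  Compactness of closed \<open>\<sigma>\<close>-convex hulls is not available in this generality, so that minimising
  over the hull is no option; the compactness of \<open>K\<close> has to enter through finite nets, and these are
  averaged by a map on finite multisets.

  For every \<open>n \<ge> 1\<close> there is a map \<open>b\<close> sending multisets of size \<open>n\<close> to points, which commutes with
  all symmetries of \<open>\<sigma>\<close>, stays inside closed hulls, and moves by at most the average displacement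
  when the points of the multiset are moved (\<open>symmetric_mean_exists\<close>). For \<open>n = 2\<close> it is the
  midpoint, and this is where the midpoint property enters: the mean of a multiset cannot know an
  order. To pass from \<open>n\<close> to \<open>n + 1\<close>, replace each point by the mean of the other \<open>n\<close> points and
  iterate; two such means share all but one point, so each round shrinks the diameter by the factor
  \<open>1/n\<close>, and the rounds converge to a single point. This is the barycentre of Es-Sahib and Heinich.
  
  A smallest \<open>e/2\<close>-net \<open>N\<close> of a compact set \<open>K\<close> is almost invariant: if a symmetry \<open>\<phi>\<close> preserves \<open>K\<close>,
  then \<open>\<phi> ` N\<close> is again a smallest net, and Hall's theorem matches the two nets with all distances
  at most \<open>e\<close> (\<open>minimal_net_almost_invariant\<close>). Hence the mean \<open>p\<close> of \<open>N\<close> satisfies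
  \<open>dist p (\<phi> p) \<le> e\<close> for every such \<open>\<phi>\<close>. The orbit of \<open>p\<close> under all of them is totally bounded,
  because its points are means of \<open>card N\<close> points of \<open>K\<close>; its closure is a compact set that is again
  invariant, lies in the closed hull of \<open>K\<close> and has diameter at most \<open>e\<close>
  (\<open>small_invariant_compactum\<close>).
  
  Repeating this gives invariant compact sets whose closed hulls are nested with diameters tending to
  \<open>0\<close>. Taking hulls does not increase the diameter, as balls are convex, so by completeness the
  hulls meet in one point, which every symmetry that preserves \<open>K\<close> must fix. The given semigroup
  consists of such symmetries; passing to the group of all of them is what makes orbits invariant.
\<close>

section \<open>Matching in finite set systems\<close>

text \<open>
  Induction on \<open>A\<close>. If some nonempty proper subset \<open>B\<close> has exactly \<open>card B\<close> candidates, match \<open>B\<close>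
  first; Hall's condition survives for \<open>A - B\<close> once the used candidates are removed. Otherwise
  every such subset has a candidate to spare, so any one element may be matched arbitrarily.
\<close>

lemma hall_marriage:
  assumes "finite A" "\<And>x. x \<in> A \<Longrightarrow> finite (G x)"
    and "\<And>B. B \<subseteq> A \<Longrightarrow> card B \<le> card (\<Union>(G ` B))"
  shows "\<exists>f. inj_on f A \<and> (\<forall>x\<in>A. f x \<in> G x)"
  using assms
proof (induction A arbitrary: G rule: finite_psubset_induct)
  case (psubset A)
  have finU: "finite (\<Union>(G ` B))" if "B \<subseteq> A" for B
    using that psubset.hyps psubset.prems(1) finite_subset by blast
  show ?case
  proof (cases "\<exists>B. B \<noteq> {} \<and> B \<subset> A \<and> card (\<Union>(G ` B)) = card B")
    case True
    then obtain B where B: "B \<noteq> {}" "B \<subset> A" "card (\<Union>(G ` B)) = card B"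
      by blast
    define U where "U = \<Union>(G ` B)"
    have finB: "finite B"
      using B(2) psubset.hyps finite_subset by blast
    have "\<exists>f. inj_on f B \<and> (\<forall>x\<in>B. f x \<in> G x)"
      using B(2) psubset.prems by (intro psubset.IH) auto
    then obtain f where f: "inj_on f B" "\<And>x. x \<in> B \<Longrightarrow> f x \<in> G x"
      by blast
    have "\<exists>g. inj_on g (A - B) \<and> (\<forall>x\<in>A - B. g x \<in> G x - U)"
    proof (rule psubset.IH)
      show "A - B \<subset> A"
        using B by blast
      show "finite (G x - U)" if "x \<in> A - B" for x
        using that psubset.prems(1) by blast
      fix E assume E: "E \<subseteq> A - B"
      then have sub: "E \<union> B \<subseteq> A"
        using B(2) by blast
      have "finite E"
        using E psubset.hyps finite_subset by blast
      then have "card E + card B = card (E \<union> B)"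
        using E finB by (subst card_Un_disjoint) auto
      also have "\<dots> \<le> card (\<Union>(G ` (E \<union> B)))"
        using sub by (rule psubset.prems(2))
      finally have "card E \<le> card (\<Union>(G ` (E \<union> B))) - card U"
        using B(3) U_def by simp
      also have "\<dots> = card (\<Union>(G ` (E \<union> B)) - U)"
        using B(2) finU[of B] by (subst card_Diff_subset) (auto simp: U_def)
      also have "\<Union>(G ` (E \<union> B)) - U = \<Union>((\<lambda>x. G x - U) ` E)"
        by (auto simp: U_def)
      finally show "card E \<le> card (\<Union>((\<lambda>x. G x - U) ` E))" .
    qed
    then obtain g where g: "inj_on g (A - B)" "\<And>x. x \<in> A - B \<Longrightarrow> g x \<in> G x - U"
      by blast
    define h where "h x = (if x \<in> B then f x else g x)" for x
    have "f x \<in> U" if "x \<in> B" for x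
      using that f(2) by (auto simp: U_def)
    moreover have "g x \<notin> U" if "x \<in> A - B" for x
      using that g(2) by blast
    ultimately have "inj_on h A"
      using f(1) g(1) unfolding h_def inj_on_def by (metis DiffI)
    moreover have "\<forall>x\<in>A. h x \<in> G x"
      using f(2) g(2) by (auto simp: h_def)
    ultimately show ?thesis
      by blast
  next
    case False
    then have slack: "card B < card (\<Union>(G ` B))" if "B \<noteq> {}" "B \<subset> A" for B
      using psubset.prems(2)[of B] that by (metis le_neq_implies_less psubset_imp_subset)
    show ?thesis
    proof (cases "A = {}")
      case False
      then obtain a where a: "a \<in> A"
        by blast
      have "G a \<noteq> {}"
        using psubset.prems(2)[of "{a}"] a by auto
      then obtain y where y: "y \<in> G a"
        by blast
      \<comment> \<open>With a candidate to spare, removing \<open>y\<close> costs each subset at most that one.\<close>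
      have "\<exists>f. inj_on f (A - {a}) \<and> (\<forall>x\<in>A - {a}. f x \<in> G x - {y})"
      proof (rule psubset.IH)
        show "A - {a} \<subset> A"
          using a by blast
        show "finite (G x - {y})" if "x \<in> A - {a}" for x
          using that psubset.prems(1) by blast
        fix B assume B: "B \<subseteq> A - {a}"
        show "card B \<le> card (\<Union>((\<lambda>x. G x - {y}) ` B))"
        proof (cases "B = {}")
          case False
          then have "card B < card (\<Union>(G ` B))"
            using B a by (intro slack) auto
          also have "\<dots> \<le> Suc (card (\<Union>(G ` B) - {y}))"
            using diff_card_le_card_Diff[of "{y}" "\<Union>(G ` B)"] by simp
          also have "\<Union>(G ` B) - {y} = \<Union>((\<lambda>x. G x - {y}) ` B)"
            by auto
          finally show ?thesis
            by simp
        qed simp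
      qed
      then obtain f where f: "inj_on f (A - {a})" "\<And>x. x \<in> A - {a} \<Longrightarrow> f x \<in> G x - {y}"
        by blast
      have "inj_on (f(a := y)) A" "\<forall>x\<in>A. (f(a := y)) x \<in> G x"
        using f y by (auto simp: inj_on_def)
      then show ?thesis
        by blast
    qed simp
  qed
qed


section \<open>Closed convex hulls\<close>

definition sigma_convex :: "('a \<Rightarrow> 'a \<Rightarrow> real \<Rightarrow> 'a) \<Rightarrow> 'a set \<Rightarrow> bool" where
  "sigma_convex \<sigma> C \<longleftrightarrow> (\<forall>x\<in>C. \<forall>y\<in>C. \<forall>t\<in>{0..1}. \<sigma> x y t \<in> C)"

definition symmetries :: "('a::metric_space \<Rightarrow> 'a \<Rightarrow> real \<Rightarrow> 'a) \<Rightarrow> ('a \<Rightarrow> 'a) set" where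
  "symmetries \<sigma> = {\<phi> \<in> isometries. equivariant_map \<sigma> \<phi>}"

definition setwise_stabiliser ::
    "('a::metric_space \<Rightarrow> 'a \<Rightarrow> real \<Rightarrow> 'a) \<Rightarrow> 'a set \<Rightarrow> ('a \<Rightarrow> 'a) set" where
  "setwise_stabiliser \<sigma> K = {\<phi> \<in> symmetries \<sigma>. \<phi> ` K = K}"

lemma sigma_convexD: "sigma_convex \<sigma> C \<Longrightarrow> x \<in> C \<Longrightarrow> y \<in> C \<Longrightarrow> t \<in> {0..1} \<Longrightarrow> \<sigma> x y t \<in> C"
  by (auto simp: sigma_convex_def)

lemma symmetries_dist: "\<phi> \<in> symmetries \<sigma> \<Longrightarrow> dist (\<phi> x) (\<phi> y) = dist x y"
  by (simp add: symmetries_def isometries_def)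

lemma symmetries_bij: "\<phi> \<in> symmetries \<sigma> \<Longrightarrow> bij \<phi>"
  by (simp add: symmetries_def isometries_def)

lemma symmetries_sigma:
  "\<phi> \<in> symmetries \<sigma> \<Longrightarrow> t \<in> {0..1} \<Longrightarrow> \<phi> (\<sigma> x y t) = \<sigma> (\<phi> x) (\<phi> y) t"
  by (simp add: symmetries_def equivariant_map_def)

lemma symmetries_continuous: "\<phi> \<in> symmetries \<sigma> \<Longrightarrow> continuous_on A \<phi>"
  unfolding continuous_on_iff by (metis symmetries_dist)

lemma symmetries_comp: "\<phi> \<in> symmetries \<sigma> \<Longrightarrow> \<psi> \<in> symmetries \<sigma> \<Longrightarrow> \<phi> \<circ> \<psi> \<in> symmetries \<sigma>"
  by (auto simp: symmetries_def isometries_def equivariant_map_def bij_comp)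

lemma symmetries_inv:
  assumes "\<phi> \<in> symmetries \<sigma>"
  shows "inv \<phi> \<in> symmetries \<sigma>"
proof -
  note b = symmetries_bij[OF assms]
  have s: "\<phi> (inv \<phi> x) = x" and i: "inv \<phi> (\<phi> x) = x" for x
    using b by (simp_all add: bij_is_surj surj_f_inv_f bij_is_inj)
  have "dist (inv \<phi> x) (inv \<phi> y) = dist x y" for x y
    using symmetries_dist[OF assms, of "inv \<phi> x" "inv \<phi> y"] s by simp
  moreover have "inv \<phi> (\<sigma> x y t) = \<sigma> (inv \<phi> x) (inv \<phi> y) t" if "t \<in> {0..1}" for x y t
    using symmetries_sigma[OF assms that, of "inv \<phi> x" "inv \<phi> y"] s i by metis
  ultimately show ?thesis
    using b by (simp add: symmetries_def isometries_def equivariant_map_def bij_imp_bij_inv)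
qed

lemma id_in_setwise_stabiliser: "id \<in> setwise_stabiliser \<sigma> K"
  by (simp add: setwise_stabiliser_def symmetries_def isometries_def equivariant_map_def)

lemma setwise_stabiliser_comp:
  "\<phi> \<in> setwise_stabiliser \<sigma> K \<Longrightarrow> \<psi> \<in> setwise_stabiliser \<sigma> K \<Longrightarrow>
     \<phi> \<circ> \<psi> \<in> setwise_stabiliser \<sigma> K"
  by (auto simp: setwise_stabiliser_def symmetries_comp simp flip: image_image)

lemma setwise_stabiliser_inv:
  assumes "\<phi> \<in> setwise_stabiliser \<sigma> K"
  shows "inv \<phi> \<in> setwise_stabiliser \<sigma> K"
proof -
  have "\<phi> \<in> symmetries \<sigma>" "\<phi> ` K = K"
    using assms by (auto simp: setwise_stabiliser_def)
  then have "inv \<phi> ` K = K"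
    by (metis symmetries_bij bij_is_inj image_inv_f_f)
  then show ?thesis
    using \<open>\<phi> \<in> symmetries \<sigma>\<close> by (simp add: setwise_stabiliser_def symmetries_inv)
qed

locale conical_bicombing =
  fixes \<sigma> :: "'a::complete_space \<Rightarrow> 'a \<Rightarrow> real \<Rightarrow> 'a"
  assumes conical: "conical_geodesic_bicombing \<sigma>"
begin

lemma conical_dist:
  "t \<in> {0..1} \<Longrightarrow> dist (\<sigma> x y t) (\<sigma> x' y' t) \<le> (1 - t) * dist x x' + t * dist y y'"
  using conical by (auto simp: conical_geodesic_bicombing_def)

lemma geodesic: "constant_speed_geodesic (\<sigma> x y) x y"
  using conical by (auto simp: conical_geodesic_bicombing_def)

lemma sigma_0 [simp]: "\<sigma> x y 0 = x"
  using geodesic[of x y] by (auto simp: constant_speed_geodesic_def)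

lemma sigma_self [simp]:
  assumes "t \<in> {0..1}"
  shows "\<sigma> x x t = x"
proof -
  have "dist (\<sigma> x x t) (\<sigma> x x 0) = \<bar>t - 0\<bar> * dist x x"
    using geodesic[of x x] assms unfolding constant_speed_geodesic_def by (metis atLeastAtMost_iff
        order_refl zero_le_one)
  then show ?thesis
    by simp
qed

definition closed_hull :: "'a set \<Rightarrow> 'a set" where
  "closed_hull A = (\<lambda>C. closed C \<and> sigma_convex \<sigma> C) hull A"

lemma closed_closed_hull: "closed (closed_hull A)"
  and sigma_convex_closed_hull: "sigma_convex \<sigma> (closed_hull A)"
  unfolding closed_hull_def hull_def by (auto simp: sigma_convex_def)

lemma closed_hull_superset: "A \<subseteq> closed_hull A"
  unfolding closed_hull_def by (rule hull_subset)

lemma closed_hull_minimal: "A \<subseteq> C \<Longrightarrow> closed C \<Longrightarrow> sigma_convex \<sigma> C \<Longrightarrow> closed_hull A \<subseteq> C"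
  unfolding closed_hull_def by (rule hull_minimal) auto

text \<open>
  The constant geodesic at \<open>z\<close> is compared with \<open>\<sigma> x y\<close> through the conical inequality.
\<close>

lemma sigma_convex_cball: "sigma_convex \<sigma> (cball z r)"
  unfolding sigma_convex_def
proof (intro ballI)
  fix x y t assume xy: "x \<in> cball z r" "y \<in> cball z r" and t: "t \<in> {0..1::real}"
  have "dist z (\<sigma> x y t) = dist (\<sigma> z z t) (\<sigma> x y t)"
    using t by simp
  also have "\<dots> \<le> (1 - t) * dist z x + t * dist z y"
    using t by (rule conical_dist)
  also have "\<dots> \<le> (1 - t) * r + t * r"
    using xy t by (intro add_mono mult_left_mono) auto
  finally show "\<sigma> x y t \<in> cball z r"
    by (simp add: algebra_simps)
qed

text \<open>
  Each point of \<open>A\<close> has \<open>A\<close>, and therefore the hull of \<open>A\<close>, in its closed ball of radius \<open>e\<close>. By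
  symmetry of the distance every hull point has \<open>A\<close> in its ball, hence the whole hull too.
\<close>

lemma dist_closed_hull_le:
  assumes "\<And>x y. x \<in> A \<Longrightarrow> y \<in> A \<Longrightarrow> dist x y \<le> e"
    and "u \<in> closed_hull A" "v \<in> closed_hull A"
  shows "dist u v \<le> e"
proof -
  have "closed_hull A \<subseteq> cball x e" if "x \<in> A" for x
    using assms(1) that by (intro closed_hull_minimal sigma_convex_cball) auto
  then have "A \<subseteq> cball u e"
    using assms(2) by (metis dist_commute mem_cball subsetD subsetI)
  then have "closed_hull A \<subseteq> cball u e"
    by (intro closed_hull_minimal sigma_convex_cball) auto
  then show ?thesis
    using assms(3) by auto
qed

lemma symmetry_closed_hull:
  assumes "\<phi> \<in> symmetries \<sigma>"
  shows "\<phi> ` closed_hull A \<subseteq> closed_hull (\<phi> ` A)"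
proof -
  have "closed_hull A \<subseteq> \<phi> -` closed_hull (\<phi> ` A)"
  proof (rule closed_hull_minimal)
    show "A \<subseteq> \<phi> -` closed_hull (\<phi> ` A)"
      using closed_hull_superset by blast
    show "closed (\<phi> -` closed_hull (\<phi> ` A))"
      using closed_closed_hull symmetries_continuous[OF assms, of UNIV]
      by (intro closed_vimage) (auto simp: continuous_on_eq_continuous_at)
    show "sigma_convex \<sigma> (\<phi> -` closed_hull (\<phi> ` A))"
      using sigma_convex_closed_hull symmetries_sigma[OF assms]
      unfolding sigma_convex_def by (metis vimage_eq)
  qed
  then show ?thesis
    by blast
qed

text \<open>
  Cantor's intersection theorem for hulls. It serves both to define means as limits and to find the
  fixed point itself.
\<close>

lemma closed_hull_nest:
  assumes "\<And>n. A n \<noteq> {}" and step: "\<And>n. A (Suc n) \<subseteq> closed_hull (A n)"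
    and small: "\<And>e. e > 0 \<Longrightarrow> \<exists>n. \<forall>x\<in>A n. \<forall>y\<in>A n. dist x y \<le> e"
  shows "\<exists>a. (\<Inter>n. closed_hull (A n)) = {a}"
proof (rule decreasing_closed_nest_sing)
  show "closed (closed_hull (A n))" for n
    by (rule closed_closed_hull)
  show "closed_hull (A n) \<noteq> {}" for n
    using assms(1) closed_hull_superset by blast
  have "closed_hull (A (Suc n)) \<subseteq> closed_hull (A n)" for n
    by (intro closed_hull_minimal step closed_closed_hull sigma_convex_closed_hull)
  then show "closed_hull (A n) \<subseteq> closed_hull (A m)" if "m \<le> n" for m n
    using that by (rule lift_Suc_antimono_le)
  fix e :: real assume "e > 0"
  then obtain n where n: "\<And>x y. x \<in> A n \<Longrightarrow> y \<in> A n \<Longrightarrow> dist x y \<le> e / 2"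
    using small[of "e/2"] by (metis half_gt_zero)
  have "dist u v < e" if "u \<in> closed_hull (A n)" "v \<in> closed_hull (A n)" for u v
    using dist_closed_hull_le[OF n that] \<open>e > 0\<close> by simp
  then show "\<exists>n. \<forall>x\<in>closed_hull (A n). \<forall>y\<in>closed_hull (A n). dist x y < e"
    by blast
qed

lemma conv_stage_mono:
  assumes "m \<le> n"
  shows "conv_stage \<sigma> A m \<subseteq> conv_stage \<sigma> A n"
proof -
  have "x \<in> conv_stage \<sigma> A (Suc k)" if "x \<in> conv_stage \<sigma> A k" for x k
    using that sigma_0[of x x] by (auto intro!: exI[of _ x] exI[of _ "0::real"])
  then have "conv_stage \<sigma> A k \<subseteq> conv_stage \<sigma> A (Suc k)" for k
    by (rule subsetI)
  then show ?thesis
    using assms by (rule lift_Suc_mono_le)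
qed

lemma sigma_convex_sigma_convex_hull: "sigma_convex \<sigma> (sigma_convex_hull \<sigma> A)"
  unfolding sigma_convex_def
proof (intro ballI)
  fix x y t assume "x \<in> sigma_convex_hull \<sigma> A" "y \<in> sigma_convex_hull \<sigma> A" and t: "t \<in> {0..1::real}"
  then obtain i j where "x \<in> conv_stage \<sigma> A i" "y \<in> conv_stage \<sigma> A j"
    by (auto simp: sigma_convex_hull_def)
  then have "x \<in> conv_stage \<sigma> A (max i j)" "y \<in> conv_stage \<sigma> A (max i j)"
    using conv_stage_mono by (meson max.cobounded1 max.cobounded2 subsetD)+
  then have "\<sigma> x y t \<in> conv_stage \<sigma> A (Suc (max i j))"
    using t by auto
  then show "\<sigma> x y t \<in> sigma_convex_hull \<sigma> A"
    unfolding sigma_convex_hull_def by blast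
qed

lemma sigma_convex_closure:
  assumes "sigma_convex \<sigma> C"
  shows "sigma_convex \<sigma> (closure C)"
  unfolding sigma_convex_def
proof (intro ballI)
  fix x y t assume xy: "x \<in> closure C" "y \<in> closure C" and t: "t \<in> {0..1::real}"
  show "\<sigma> x y t \<in> closure C"
    unfolding closure_approachable
  proof (intro allI impI)
    fix e :: real assume "e > 0"
    obtain u v where uv: "u \<in> C" "v \<in> C" "dist u x < e" "dist v y < e"
      using xy \<open>e > 0\<close> unfolding closure_approachable by metis
    have "dist (\<sigma> u v t) (\<sigma> x y t) \<le> (1 - t) * dist u x + t * dist v y"
      using t by (rule conical_dist)
    also have "\<dots> < e"
      using uv t by (intro convex_bound_lt) auto
    finally show "\<exists>z\<in>C. dist z (\<sigma> x y t) < e"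
      using sigma_convexD[OF assms uv(1,2) t] by blast
  qed
qed

lemma closed_hull_subset: "closed_hull A \<subseteq> closure (sigma_convex_hull \<sigma> A)"
proof (rule closed_hull_minimal)
  have "A \<subseteq> sigma_convex_hull \<sigma> A"
    unfolding sigma_convex_hull_def using conv_stage.simps(1)[of \<sigma> A] by blast
  then show "A \<subseteq> closure (sigma_convex_hull \<sigma> A)"
    using closure_subset by blast
qed (auto intro: sigma_convex_closure sigma_convex_sigma_convex_hull)

end


section \<open>Symmetric means\<close>

lemma size_2_doubleton_mset:
  assumes "size M = 2"
  shows "\<exists>x y. M = {#x, y#}"
proof -
  obtain x N where "M = add_mset x N"
    using assms size_eq_Suc_imp_eq_union[of M 1] by auto
  moreover from this have "size N = 1"
    using assms by simp
  then obtain y where "N = {#y#}"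
    using size_1_singleton_mset by blast
  ultimately show ?thesis
    by blast
qed

text \<open>
  A mean of \<open>n\<close> points. A multiset \<open>P\<close> of pairs is a coupling of its two marginals, so the first
  axiom says that the mean is \<open>1\<close>-Lipschitz for the transport distance. With multisets in place of
  tuples the invariance under permutations is built into the type. The averaged bound, rather than
  a bound by the largest displacement, is what makes the leave-one-out iteration contract.
\<close>

locale symmetric_mean = conical_bicombing \<sigma>
  for \<sigma> :: "'a::complete_space \<Rightarrow> 'a \<Rightarrow> real \<Rightarrow> 'a" +
  fixes n :: nat and b :: "'a multiset \<Rightarrow> 'a"
  assumes mean_dist: "size P = n \<Longrightarrow>
      real n * dist (b (image_mset fst P)) (b (image_mset snd P)) \<le> (\<Sum>p\<in>#P. dist (fst p) (snd p))"
    and mean_in_hull: "size M = n \<Longrightarrow> b M \<in> closed_hull (set_mset M)"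
    and mean_equivariant: "size M = n \<Longrightarrow> \<phi> \<in> symmetries \<sigma> \<Longrightarrow> b (image_mset \<phi> M) = \<phi> (b M)"
begin

lemma mean_dist_coupling:
  assumes "n > 0" "size P = n" "\<And>p. p \<in># P \<Longrightarrow> dist (fst p) (snd p) \<le> e"
  shows "dist (b (image_mset fst P)) (b (image_mset snd P)) \<le> e"
proof -
  have "(\<Sum>p\<in>#P. dist (fst p) (snd p)) \<le> (\<Sum>p\<in>#P. e)"
    using assms(3) by (rule sum_mset_mono)
  also have "\<dots> = real n * e"
    using assms(2) by simp
  finally have "real n * dist (b (image_mset fst P)) (b (image_mset snd P)) \<le> real n * e"
    using mean_dist[OF assms(2)] by linarith
  then show ?thesis
    using assms(1) by simp
qed

definition leave_one_out :: "'a multiset \<Rightarrow> 'a multiset" where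
  "leave_one_out M = image_mset (\<lambda>x. b (M - {#x#})) M"

lemma size_leave_one_out [simp]: "size (leave_one_out M) = size M"
  by (simp add: leave_one_out_def)

lemma size_leave_one_out_iter [simp]: "size ((leave_one_out ^^ k) M) = size M"
  by (induction k) auto

lemma leave_one_out_in_hull:
  assumes "size M = Suc n"
  shows "set_mset (leave_one_out M) \<subseteq> closed_hull (set_mset M)"
proof
  fix z assume "z \<in># leave_one_out M"
  then obtain x where x: "x \<in># M" "z = b (M - {#x#})"
    by (auto simp: leave_one_out_def)
  have "z \<in> closed_hull (set_mset (M - {#x#}))"
    using x assms by (simp add: mean_in_hull size_Diff_singleton)
  also have "\<dots> \<subseteq> closed_hull (set_mset M)"
    unfolding closed_hull_def by (intro hull_mono) (auto dest: in_diffD)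
  finally show "z \<in> closed_hull (set_mset M)" .
qed

lemma leave_one_out_equivariant:
  assumes "size M = Suc n" "\<phi> \<in> symmetries \<sigma>"
  shows "leave_one_out (image_mset \<phi> M) = image_mset \<phi> (leave_one_out M)"
proof -
  have "b (image_mset \<phi> M - {#\<phi> x#}) = \<phi> (b (M - {#x#}))" if "x \<in># M" for x
    using that assms
    by (simp add: mean_equivariant[symmetric] size_Diff_singleton image_mset_Diff)
  then show ?thesis
    unfolding leave_one_out_def by (simp add: multiset.map_comp o_def cong: image_mset_cong)
qed

lemma leave_one_out_iter_equivariant:
  assumes "size M = Suc n" "\<phi> \<in> symmetries \<sigma>"
  shows "(leave_one_out ^^ k) (image_mset \<phi> M) = image_mset \<phi> ((leave_one_out ^^ k) M)"
  by (induction k) (use assms in \<open>auto simp: leave_one_out_equivariant\<close>)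

text \<open>
  The means obtained by omitting \<open>x\<close> and by omitting \<open>y\<close> are means of multisets that differ in one
  point only: coupling the common points with themselves leaves the single displacement
  \<open>dist y x\<close>, which the mean divides by \<open>n\<close>.
\<close>

lemma leave_one_out_contracts:
  assumes "n > 0" "size M = Suc n"
    and D: "\<And>x y. x \<in># M \<Longrightarrow> y \<in># M \<Longrightarrow> dist x y \<le> D"
    and "u \<in># leave_one_out M" "v \<in># leave_one_out M"
  shows "dist u v \<le> D / n"
proof -
  obtain x y where x: "x \<in># M" "u = b (M - {#x#})" and y: "y \<in># M" "v = b (M - {#y#})"
    using assms(4,5) by (auto simp: leave_one_out_def)
  show ?thesis
  proof (cases "x = y")
    case True
    then show ?thesis
      using D[of x x] x y by simp
  next
    case False
    define R where "R = M - {#x#} - {#y#}"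
    define P where "P = add_mset (y, x) (image_mset (\<lambda>r. (r, r)) R)"
    have "y \<in># M - {#x#}" "x \<in># M - {#y#}"
      using False x(1) y(1) by (metis insert_DiffM insert_noteq_member)+
    then have Mx: "M - {#x#} = add_mset y R" and My: "M - {#y#} = add_mset x R"
      unfolding R_def by (metis insert_DiffM, metis insert_DiffM diff_right_commute)
    have "size P = n"
      using Mx assms(2) x(1) unfolding P_def
      by (metis size_Diff_singleton diff_Suc_1 size_add_mset size_image_mset)
    moreover have "image_mset fst P = M - {#x#}" "image_mset snd P = M - {#y#}"
      by (simp_all add: P_def Mx My multiset.map_comp o_def)
    ultimately have "real n * dist u v \<le> (\<Sum>p\<in>#P. dist (fst p) (snd p))"
      using mean_dist[of P] x(2) y(2) by simp
    also have "\<dots> = dist y x"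
      by (simp add: P_def multiset.map_comp o_def)
    also have "\<dots> \<le> D"
      using D x y by blast
    finally show ?thesis
      using assms(1) by (simp add: field_simps)
  qed
qed

lemma leave_one_out_iter_contracts:
  assumes "n > 0" "size M = Suc n"
    and "\<And>x y. x \<in># M \<Longrightarrow> y \<in># M \<Longrightarrow> dist x y \<le> D"
  shows "u \<in># (leave_one_out ^^ k) M \<Longrightarrow> v \<in># (leave_one_out ^^ k) M \<Longrightarrow> dist u v \<le> D / n ^ k"
proof (induction k arbitrary: u v)
  case (Suc k)
  have "dist u v \<le> D / n ^ k / n"
    using Suc assms(1,2) by (intro leave_one_out_contracts[of "(leave_one_out ^^ k) M"]) auto
  then show ?case
    by (simp add: mult.commute)
qed (use assms in auto)

text \<open>
  A coupling of two multisets induces one of their leave-one-out multisets, by omitting matched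
  points simultaneously.
\<close>

definition leave_one_out_coupling :: "('a \<times> 'a) multiset \<Rightarrow> ('a \<times> 'a) multiset" where
  "leave_one_out_coupling P =
     image_mset (\<lambda>p. (b (image_mset fst (P - {#p#})), b (image_mset snd (P - {#p#})))) P"

lemma size_leave_one_out_coupling [simp]: "size (leave_one_out_coupling P) = size P"
  by (simp add: leave_one_out_coupling_def)

lemma leave_one_out_coupling_marginals:
  "image_mset fst (leave_one_out_coupling P) = leave_one_out (image_mset fst P)"
  "image_mset snd (leave_one_out_coupling P) = leave_one_out (image_mset snd P)"
  unfolding leave_one_out_coupling_def leave_one_out_def
  by (auto simp: multiset.map_comp o_def image_mset_Diff intro!: image_mset_cong)

text \<open>
  The means omitting \<open>p\<close> are at most \<open>1/n\<close> times the total cost without \<open>p\<close> apart. Summed over all \<open>p\<close>, every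
  displacement is counted \<open>n\<close> times, once for each omission of another pair.
\<close>

lemma leave_one_out_coupling_cost:
  assumes "n > 0" "size P = Suc n"
  shows "(\<Sum>p\<in>#leave_one_out_coupling P. dist (fst p) (snd p)) \<le> (\<Sum>p\<in>#P. dist (fst p) (snd p))"
proof -
  \<comment> \<open>Both sides are compared after multiplication by \<open>n\<close>, with total cost \<open>S\<close>.\<close>
  define d where "d p = dist (fst p) (snd p)" for p :: "'a \<times> 'a"
  define S where "S = (\<Sum>p\<in>#P. d p)"
  have diff: "(\<Sum>p\<in>#Q. c - d p) = real (size Q) * c - (\<Sum>p\<in>#Q. d p)" for c Q
    by (induction Q) (auto simp: algebra_simps)
  have "real n * (\<Sum>p\<in>#leave_one_out_coupling P. d p) =
      (\<Sum>p\<in>#P. real n * dist (b (image_mset fst (P - {#p#}))) (b (image_mset snd (P - {#p#}))))"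
    by (simp add: leave_one_out_coupling_def d_def multiset.map_comp o_def sum_mset_distrib_left)
  also have "\<dots> \<le> (\<Sum>p\<in>#P. S - d p)"
  proof (rule sum_mset_mono)
    fix p assume p: "p \<in># P"
    have "real n * dist (b (image_mset fst (P - {#p#}))) (b (image_mset snd (P - {#p#})))
        \<le> (\<Sum>q\<in>#P - {#p#}. d q)"
      unfolding d_def using p assms(2) by (intro mean_dist) (simp add: size_Diff_singleton)
    also have "\<dots> = S - d p"
    proof -
      have "S = d p + (\<Sum>q\<in>#P - {#p#}. d q)"
        unfolding S_def using p by (metis insert_DiffM image_mset_add_mset sum_mset.add_mset)
      then show ?thesis
        by simp
    qed
    finally show "real n * dist (b (image_mset fst (P - {#p#}))) (b (image_mset snd (P - {#p#})))
        \<le> S - d p" .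
  qed
  also have "\<dots> = real n * S"
    unfolding diff using assms(2) by (simp add: S_def algebra_simps)
  finally show ?thesis
    using assms(1) unfolding S_def d_def by simp
qed

text \<open>
  Here \<open>n > 1\<close> is essential: for \<open>n = 1\<close> a round merely swaps the two points.
\<close>

lemma leave_one_out_iter_small:
  assumes "n > 1" "size M = Suc n" "e > 0"
  shows "\<forall>\<^sub>F k in sequentially. \<forall>u v. u \<in># (leave_one_out ^^ k) M \<longrightarrow>
    v \<in># (leave_one_out ^^ k) M \<longrightarrow> dist u v \<le> e"
proof -
  have "bounded (set_mset M)"
    by (simp add: finite_imp_bounded)
  then obtain D where D: "\<And>x y. x \<in># M \<Longrightarrow> y \<in># M \<Longrightarrow> dist x y \<le> D"
    by (metis bounded_two_points)
  have "(\<lambda>k. D / real n ^ k) \<longlonglongrightarrow> 0"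
    using assms(1) by (intro LIMSEQ_divide_realpow_zero) simp
  then have "\<forall>\<^sub>F k in sequentially. D / real n ^ k < e"
    using \<open>e > 0\<close> by (rule order_tendstoD(2))
  then show ?thesis
  proof eventually_elim
    case (elim k)
    have "dist u v \<le> e" if "u \<in># (leave_one_out ^^ k) M" "v \<in># (leave_one_out ^^ k) M" for u v
      using leave_one_out_iter_contracts[OF _ assms(2) D that] assms(1) elim by simp
    then show ?case
      by blast
  qed
qed

lemma leave_one_out_limit:
  assumes "n > 1" "size M = Suc n"
  shows "\<exists>a. (\<Inter>k. closed_hull (set_mset ((leave_one_out ^^ k) M))) = {a}"
proof (rule closed_hull_nest)
  show "set_mset ((leave_one_out ^^ k) M) \<noteq> {}" for k
    by (metis size_leave_one_out_iter assms(2) set_mset_eq_empty_iff size_empty nat.distinct(1))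
  show "set_mset ((leave_one_out ^^ Suc k) M) \<subseteq> closed_hull (set_mset ((leave_one_out ^^ k) M))" for k
    using leave_one_out_in_hull assms(2) by simp
  fix e :: real assume "e > 0"
  show "\<exists>k. \<forall>x\<in>set_mset ((leave_one_out ^^ k) M).
      \<forall>y\<in>set_mset ((leave_one_out ^^ k) M). dist x y \<le> e"
    using eventually_happens'[OF sequentially_bot leave_one_out_iter_small[OF assms \<open>e > 0\<close>]]
    by blast
qed

definition limit_mean :: "'a multiset \<Rightarrow> 'a" where
  "limit_mean M = the_elem (\<Inter>k. closed_hull (set_mset ((leave_one_out ^^ k) M)))"

lemma limit_mean_eq:
  assumes "n > 1" "size M = Suc n"
  shows "(\<Inter>k. closed_hull (set_mset ((leave_one_out ^^ k) M))) = {limit_mean M}"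
  unfolding limit_mean_def using leave_one_out_limit[OF assms] by (metis the_elem_eq)

lemma limit_mean_approximates:
  assumes "n > 1" "size M = Suc n" "e > 0"
  shows "\<forall>\<^sub>F k in sequentially. \<forall>z. z \<in># (leave_one_out ^^ k) M \<longrightarrow> dist z (limit_mean M) \<le> e"
  using leave_one_out_iter_small[OF assms]
proof eventually_elim
  case (elim k)
  let ?A = "set_mset ((leave_one_out ^^ k) M)"
  have "dist z (limit_mean M) \<le> e" if "z \<in> ?A" for z
  proof (rule dist_closed_hull_le)
    show "dist x y \<le> e" if "x \<in> ?A" "y \<in> ?A" for x y
      using elim that by blast
    show "z \<in> closed_hull ?A"
      using that closed_hull_superset by blast
    show "limit_mean M \<in> closed_hull ?A"
      using limit_mean_eq[OF assms(1,2)] by blast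
  qed
  then show ?case
    by blast
qed

text \<open>
  Equivariance and containment in the hull pass from each round to the intersection of the hulls.
  For the transport inequality, iterate a coupling alongside the two multisets. Its cost never
  increases, and in late rounds its marginals are concentrated near the two limit means, so that
  the cost is almost \<open>n + 1\<close> times the distance of these.
\<close>

lemma symmetric_mean_Suc:
  assumes "n > 1"
  shows "symmetric_mean \<sigma> (Suc n) limit_mean"
proof unfold_locales
  fix M :: "'a multiset" assume M: "size M = Suc n"
  show "limit_mean M \<in> closed_hull (set_mset M)"
  proof -
    have "limit_mean M \<in> closed_hull (set_mset ((leave_one_out ^^ 0) M))"
      using limit_mean_eq[OF assms M] by blast
    then show ?thesis
      by simp
  qed
  fix \<phi> assume \<phi>: "\<phi> \<in> symmetries \<sigma>"
  have "\<phi> (limit_mean M) \<in> closed_hull (set_mset ((leave_one_out ^^ k) (image_mset \<phi> M)))" for k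
  proof -
    have "limit_mean M \<in> closed_hull (set_mset ((leave_one_out ^^ k) M))"
      using limit_mean_eq[OF assms M] by blast
    then show ?thesis
      using symmetry_closed_hull[OF \<phi>] leave_one_out_iter_equivariant[OF M \<phi>] by fastforce
  qed
  then have "\<phi> (limit_mean M) \<in> (\<Inter>k. closed_hull (set_mset ((leave_one_out ^^ k) (image_mset \<phi> M))))"
    by (rule INT_I)
  also have "\<dots> = {limit_mean (image_mset \<phi> M)}"
    using M by (intro limit_mean_eq[OF assms]) simp
  finally show "limit_mean (image_mset \<phi> M) = \<phi> (limit_mean M)"
    by simp
next
  fix P :: "('a \<times> 'a) multiset" assume P: "size P = Suc n"
  define Q where "Q k = (leave_one_out_coupling ^^ k) P" for k
  define x y where "x = limit_mean (image_mset fst P)" and "y = limit_mean (image_mset snd P)"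
  define S where "S = (\<Sum>p\<in>#P. dist (fst p) (snd p))"
  have size: "size (Q k) = Suc n" for k
    unfolding Q_def by (induction k) (use P in auto)
  have marg: "image_mset fst (Q k) = (leave_one_out ^^ k) (image_mset fst P)"
    "image_mset snd (Q k) = (leave_one_out ^^ k) (image_mset snd P)" for k
    unfolding Q_def by (induction k) (auto simp: leave_one_out_coupling_marginals)
  have cost: "(\<Sum>p\<in>#Q k. dist (fst p) (snd p)) \<le> S" for k
  proof (induction k)
    case (Suc k)
    have "(\<Sum>p\<in>#Q (Suc k). dist (fst p) (snd p)) \<le> (\<Sum>p\<in>#Q k. dist (fst p) (snd p))"
      using leave_one_out_coupling_cost[of "Q k"] assms size[of k] by (simp add: Q_def)
    then show ?case
      using Suc by linarith
  qed (simp add: Q_def S_def)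
  have "real (Suc n) * dist x y \<le> S + e" if "e > 0" for e
  proof -
    \<comment> \<open>Each of the \<open>n + 1\<close> pairs contributes an error of at most \<open>2 * \<delta>\<close>.\<close>
    define \<delta> where "\<delta> = e / (2 * real (Suc n))"
    have "\<delta> > 0" and \<delta>: "real (Suc n) * (2 * \<delta>) = e"
      using that by (simp_all add: \<delta>_def del: of_nat_Suc)
    then have near: "\<forall>\<^sub>F k in sequentially.
        (\<forall>z. z \<in># image_mset fst (Q k) \<longrightarrow> dist z x \<le> \<delta>) \<and>
        (\<forall>z. z \<in># image_mset snd (Q k) \<longrightarrow> dist z y \<le> \<delta>)"
      unfolding marg x_def y_def using assms P
      by (intro eventually_conj limit_mean_approximates) auto
    obtain k where k: "\<And>z. z \<in># image_mset fst (Q k) \<Longrightarrow> dist z x \<le> \<delta>"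
      "\<And>z. z \<in># image_mset snd (Q k) \<Longrightarrow> dist z y \<le> \<delta>"
      using eventually_happens'[OF sequentially_bot near] by blast
    have "real (Suc n) * dist x y = (\<Sum>p\<in>#Q k. dist x y)"
      using size[of k] by simp
    also have "\<dots> \<le> (\<Sum>p\<in>#Q k. dist (fst p) (snd p) + 2 * \<delta>)"
    proof (rule sum_mset_mono)
      fix p assume "p \<in># Q k"
      then have "dist (fst p) x \<le> \<delta>" "dist (snd p) y \<le> \<delta>"
        using k by auto
      then show "dist x y \<le> dist (fst p) (snd p) + 2 * \<delta>"
        using dist_triangle[of x y "fst p"] dist_triangle[of "fst p" y "snd p"]
        by (simp add: dist_commute)
    qed
    also have "\<dots> = (\<Sum>p\<in>#Q k. dist (fst p) (snd p)) + e"
      using size[of k] \<delta> by (simp add: sum_mset.distrib del: of_nat_Suc)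
    finally show ?thesis
      using cost[of k] by linarith
  qed
  then show "real (Suc n) * dist (limit_mean (image_mset fst P)) (limit_mean (image_mset snd P))
      \<le> (\<Sum>p\<in>#P. dist (fst p) (snd p))"
    unfolding x_def y_def S_def by (rule field_le_epsilon)
qed

end

context conical_bicombing
begin

lemma symmetric_mean_1: "symmetric_mean \<sigma> 1 (\<lambda>M. the_elem (set_mset M))"
proof unfold_locales
  fix P :: "('a \<times> 'a) multiset" assume "size P = 1"
  then obtain p where "P = {#p#}"
    using size_1_singleton_mset by blast
  then show "real 1 * dist (the_elem (set_mset (image_mset fst P))) (the_elem (set_mset (image_mset snd P)))
      \<le> (\<Sum>p\<in>#P. dist (fst p) (snd p))"
    by simp
next
  fix M :: "'a multiset" assume "size M = 1"
  then obtain x where M: "M = {#x#}"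
    using size_1_singleton_mset by blast
  then show "the_elem (set_mset M) \<in> closed_hull (set_mset M)"
    using closed_hull_superset[of "{x}"] by simp
  show "the_elem (set_mset (image_mset \<phi> M)) = \<phi> (the_elem (set_mset M))" for \<phi>
    using M by simp
qed

definition pair_midpoint :: "'a multiset \<Rightarrow> 'a" where
  "pair_midpoint M = (SOME z. \<exists>x y. M = {#x, y#} \<and> z = \<sigma> x y (1/2))"

lemma pair_midpoint_eq:
  assumes "midpoint_property \<sigma>"
  shows "pair_midpoint {#x, y#} = \<sigma> x y (1/2)"
proof -
  have "\<sigma> u v (1/2) = \<sigma> x y (1/2)" if "{#x, y#} = {#u, v#}" for u v
    using that assms by (auto simp: midpoint_property_def add_eq_conv_ex)
  then show ?thesis
    unfolding pair_midpoint_def by (intro some_equality) blast+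
qed

lemma symmetric_mean_2:
  assumes "midpoint_property \<sigma>"
  shows "symmetric_mean \<sigma> 2 pair_midpoint"
proof unfold_locales
  note [simp] = pair_midpoint_eq[OF assms]
  fix P :: "('a \<times> 'a) multiset" assume "size P = 2"
  then obtain p q where P: "P = {#p, q#}"
    using size_2_doubleton_mset by blast
  then show "real 2 * dist (pair_midpoint (image_mset fst P)) (pair_midpoint (image_mset snd P))
      \<le> (\<Sum>p\<in>#P. dist (fst p) (snd p))"
    using conical_dist[of "1/2" "fst p" "fst q" "snd p" "snd q"] by simp
next
  note [simp] = pair_midpoint_eq[OF assms]
  fix M :: "'a multiset" assume "size M = 2"
  then obtain x y where M: "M = {#x, y#}"
    using size_2_doubleton_mset by blast
  then show "pair_midpoint M \<in> closed_hull (set_mset M)"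
    using closed_hull_superset[of "{x, y}"]
    by (auto intro!: sigma_convexD[OF sigma_convex_closed_hull])
  show "pair_midpoint (image_mset \<phi> M) = \<phi> (pair_midpoint M)" if "\<phi> \<in> symmetries \<sigma>" for \<phi>
    using M symmetries_sigma[OF that, of "1/2" x y] by simp
qed

text \<open>
  The size \<open>1\<close> needs separate treatment, as the leave-one-out step only starts from \<open>n = 2\<close>.
\<close>

lemma symmetric_mean_exists:
  assumes "midpoint_property \<sigma>" "n > 0"
  shows "\<exists>b. symmetric_mean \<sigma> n b"
proof (cases "n = 1")
  case False
  then have "n \<ge> 2"
    using assms(2) by simp
  then show ?thesis
  proof (induction n rule: dec_induct)
    case base
    show ?case
      using symmetric_mean_2[OF assms(1)] by blast
  next
    case (step n)
    then obtain b where "symmetric_mean \<sigma> n b"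
      by blast
    then interpret symmetric_mean \<sigma> n b .
    show ?case
      using symmetric_mean_Suc step by auto
  qed
qed (use symmetric_mean_1 in blast)

end


section \<open>Almost invariant nets and the fixed point\<close>

text \<open>
  Match \<open>x \<in> N\<close> with \<open>y \<in> \<phi> ` N\<close> if \<open>dist x y \<le> e\<close>. Hall's condition comes from minimality:
  replacing a part \<open>B\<close> of \<open>N\<close> by its set of candidates gives a net again, because a point \<open>z\<close> of \<open>K\<close>
  covered by \<open>x \<in> B\<close> is also covered by some \<open>y \<in> \<phi> ` N\<close>, and then \<open>y\<close> is a candidate for \<open>x\<close>.
\<close>

lemma minimal_net_almost_invariant:
  fixes K :: "'a::metric_space set"
  assumes "compact K" "K \<noteq> {}" "e > 0"
  obtains N where "finite N" "N \<noteq> {}" "N \<subseteq> K"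
    "\<And>\<phi>. (\<And>x y. dist (\<phi> x) (\<phi> y) = dist x y) \<Longrightarrow> \<phi> ` K = K \<Longrightarrow>
        \<exists>f. bij_betw f N (\<phi> ` N) \<and> (\<forall>x\<in>N. dist x (f x) \<le> e)"
proof -
  \<comment> \<open>The radius \<open>e/2\<close> makes centres of overlapping balls lie within \<open>e\<close> of each other.\<close>
  define net where "net N \<longleftrightarrow> finite N \<and> N \<subseteq> K \<and> K \<subseteq> (\<Union>x\<in>N. ball x (e/2))" for N
  have "\<exists>N. net N"
    using compactE_image[OF assms(1), of K "\<lambda>x. ball x (e/2)"] assms(3)
    unfolding net_def by (metis UN_I centre_in_ball half_gt_zero open_ball subsetI)
  then obtain N where N: "net N" and least: "\<And>N'. net N' \<Longrightarrow> card N \<le> card N'"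
    by (metis ex_has_least_nat)
  have matching: "\<exists>f. bij_betw f N (\<phi> ` N) \<and> (\<forall>x\<in>N. dist x (f x) \<le> e)"
    if \<phi>: "\<And>x y. dist (\<phi> x) (\<phi> y) = dist x y" and \<phi>K: "\<phi> ` K = K" for \<phi>
  proof -
    have fin: "finite N" "finite (\<phi> ` N)"
      using N by (auto simp: net_def)
    have \<phi>N: "K \<subseteq> (\<Union>y\<in>\<phi> ` N. ball y (e/2))"
    proof
      fix z assume "z \<in> K"
      then obtain w where w: "w \<in> K" "z = \<phi> w"
        using \<phi>K by blast
      then show "z \<in> (\<Union>y\<in>\<phi> ` N. ball y (e/2))"
        using N \<phi> by (force simp: net_def)
    qed
    define G where "G x = {y \<in> \<phi> ` N. dist x y \<le> e}" for x
    have "\<exists>f. inj_on f N \<and> (\<forall>x\<in>N. f x \<in> G x)"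
    proof (rule hall_marriage)
      show "finite N" "\<And>x. finite (G x)"
        using fin by (auto simp: G_def)
      fix B assume B: "B \<subseteq> N"
      then have finB: "finite B"
        using fin(1) finite_subset by blast
      have "net ((N - B) \<union> \<Union>(G ` B))"
        unfolding net_def
      proof (intro conjI subsetI)
        show "finite ((N - B) \<union> \<Union>(G ` B))"
          using fin finB by (auto simp: G_def)
        show "z \<in> K" if "z \<in> (N - B) \<union> \<Union>(G ` B)" for z
          using that N \<phi>K by (auto simp: net_def G_def)
        fix z assume z: "z \<in> K"
        then have "z \<in> (\<Union>x\<in>N. ball x (e/2))" "z \<in> (\<Union>y\<in>\<phi> ` N. ball y (e/2))"
          using N \<phi>N unfolding net_def by blast+
        then obtain x y where x: "x \<in> N" "dist x z < e/2" and y: "y \<in> \<phi> ` N" "dist y z < e/2"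
          unfolding UN_iff mem_ball by blast
        have "dist x y \<le> e"
          using x y dist_triangle2[of x y z] by simp
        then have "y \<in> G x"
          using y by (simp add: G_def)
        then show "z \<in> (\<Union>x\<in>(N - B) \<union> \<Union>(G ` B). ball x (e/2))"
          using x y by (cases "x \<in> B") auto
      qed
      then have "card N \<le> card ((N - B) \<union> \<Union>(G ` B))"
        by (rule least)
      also have "\<dots> \<le> card (N - B) + card (\<Union>(G ` B))"
        by (rule card_Un_le)
      also have "card (N - B) = card N - card B"
        using B finB by (rule card_Diff_subset[rotated])
      finally show "card B \<le> card (\<Union>(G ` B))"
        using card_mono[OF fin(1) B] by linarith
    qed
    then obtain f where f: "inj_on f N" "\<And>x. x \<in> N \<Longrightarrow> f x \<in> G x"
      by blast
    have "f ` N = \<phi> ` N"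
    proof (rule card_subset_eq)
      show "f ` N \<subseteq> \<phi> ` N"
        using f(2) by (auto simp: G_def)
      have "card (\<phi> ` N) \<le> card N"
        using fin(1) by (rule card_image_le)
      then show "card (f ` N) = card (\<phi> ` N)"
        using card_mono[OF fin(2) \<open>f ` N \<subseteq> \<phi> ` N\<close>] card_image[OF f(1)] by simp
    qed (use fin in auto)
    then show ?thesis
      using f by (auto simp: bij_betw_def G_def)
  qed
  show thesis
    using N assms(2) matching by (intro that[of N]) (auto simp: net_def)
qed

context conical_bicombing
begin

text \<open>
  The closure of the orbit of the mean of an almost invariant net. The orbit is totally bounded
  for a reason that does not apply to the whole hull: all its points are means of the same number of
  points of \<open>K\<close>, and moving these points to a finite net of \<open>K\<close> leaves finitely many means.
\<close>

lemma small_invariant_compactum: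
  assumes mid: "midpoint_property \<sigma>" and K: "compact K" "K \<noteq> {}" and "e > 0"
  shows "\<exists>K'. compact K' \<and> K' \<noteq> {} \<and> K' \<subseteq> closed_hull K \<and> (\<forall>x\<in>K'. \<forall>y\<in>K'. dist x y \<le> e) \<and>
    setwise_stabiliser \<sigma> K \<subseteq> setwise_stabiliser \<sigma> K'"
proof -
  define G where "G = setwise_stabiliser \<sigma> K"
  have G: "\<phi> \<in> symmetries \<sigma>" "\<phi> ` K = K" if "\<phi> \<in> G" for \<phi>
    using that by (auto simp: G_def setwise_stabiliser_def)
  obtain N where N: "finite N" "N \<noteq> {}" "N \<subseteq> K"
    and match: "\<And>\<phi>. (\<And>x y. dist (\<phi> x) (\<phi> y) = dist x y) \<Longrightarrow> \<phi> ` K = K \<Longrightarrow>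
        \<exists>f. bij_betw f N (\<phi> ` N) \<and> (\<forall>x\<in>N. dist x (f x) \<le> e)"
    using minimal_net_almost_invariant[OF K \<open>e > 0\<close>] by metis
  define n where "n = card N"
  have n: "n > 0"
    using N by (simp add: n_def card_gt_0_iff)
  obtain b where "symmetric_mean \<sigma> n b"
    using symmetric_mean_exists[OF mid n] by blast
  then interpret symmetric_mean \<sigma> n b .
  have size: "size (mset_set N) = n"
    by (simp add: n_def)
  define p where "p = b (mset_set N)"
  have p_image: "\<phi> p = b (image_mset \<phi> (mset_set N))" if "\<phi> \<in> G" for \<phi>
    unfolding p_def using mean_equivariant[OF size] G(1)[OF that] by simp
  have almost_fixed: "dist p (\<phi> p) \<le> e" if \<phi>: "\<phi> \<in> G" for \<phi>
  proof -
    obtain f where f: "bij_betw f N (\<phi> ` N)" "\<And>x. x \<in> N \<Longrightarrow> dist x (f x) \<le> e"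
      using match[of \<phi>] G[OF \<phi>] symmetries_dist[OF G(1)[OF \<phi>]] by blast
    define P where "P = image_mset (\<lambda>x. (x, f x)) (mset_set N)"
    have "inj_on \<phi> N"
      using symmetries_bij[OF G(1)[OF \<phi>]] by (meson bij_is_inj inj_on_subset subset_UNIV)
    then have "image_mset snd P = image_mset \<phi> (mset_set N)"
      using f(1) by (simp add: P_def multiset.map_comp o_def image_mset_mset_set bij_betw_def)
    moreover have "image_mset fst P = mset_set N"
      by (simp add: P_def multiset.map_comp o_def)
    moreover have "dist (b (image_mset fst P)) (b (image_mset snd P)) \<le> e"
      using n f(2) N(1) size by (intro mean_dist_coupling) (auto simp: P_def)
    ultimately show ?thesis
      using p_image[OF \<phi>] by (simp add: p_def)
  qed
  \<comment> \<open>Since \<open>G\<close> is a group, a bound for displacements of \<open>p\<close> bounds the diameter of its orbit.\<close>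
  define Orb where "Orb = (\<lambda>\<phi>. \<phi> p) ` G"
  have p_Orb: "p \<in> Orb"
    unfolding Orb_def G_def using id_in_setwise_stabiliser by (metis id_apply imageI)
  have Orb_dist: "dist x y \<le> e" if "x \<in> Orb" "y \<in> Orb" for x y
  proof -
    obtain \<phi> \<psi> where x: "\<phi> \<in> G" "x = \<phi> p" and y: "\<psi> \<in> G" "y = \<psi> p"
      using \<open>x \<in> Orb\<close> \<open>y \<in> Orb\<close> by (auto simp: Orb_def)
    have "inv \<phi> \<circ> \<psi> \<in> G"
      using x y unfolding G_def by (intro setwise_stabiliser_comp setwise_stabiliser_inv)
    moreover have "dist x y = dist p ((inv \<phi> \<circ> \<psi>) p)"
    proof -
      have "\<phi> ((inv \<phi> \<circ> \<psi>) p) = y"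
        using symmetries_bij[OF G(1)[OF x(1)]] y by (simp add: bij_is_surj surj_f_inv_f)
      then show ?thesis
        using symmetries_dist[OF G(1)[OF x(1)]] x(2) by metis
    qed
    ultimately show ?thesis
      using almost_fixed by metis
  qed
  have Orb_hull: "Orb \<subseteq> closed_hull K"
  proof
    fix x assume "x \<in> Orb"
    then obtain \<phi> where \<phi>: "\<phi> \<in> G" "x = \<phi> p"
      by (auto simp: Orb_def)
    have "x \<in> closed_hull (\<phi> ` N)"
      using mean_in_hull[of "image_mset \<phi> (mset_set N)"] p_image \<phi> size N(1) by simp
    also have "\<dots> \<subseteq> closed_hull K"
      unfolding closed_hull_def using N(3) G(2)[OF \<phi>(1)] by (intro hull_mono) blast
    finally show "x \<in> closed_hull K" .
  qed
  have "compact (closure Orb)"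
    unfolding compact_eq_totally_bounded
  proof (intro conjI allI impI)
    show "complete (closure Orb)"
      by (simp add: complete_eq_closed)
    fix r :: real assume "r > 0"
    obtain E where E: "finite E" "E \<subseteq> K" "K \<subseteq> (\<Union>x\<in>E. ball x (r/3))"
      using compactE_image[OF K(1), of K "\<lambda>x. ball x (r/3)"] \<open>r > 0\<close>
      by (metis UN_I centre_in_ball divide_pos_pos open_ball subsetI zero_less_numeral)
    have "\<exists>y\<in>E. dist x y < r/3" if "x \<in> K" for x
      using subsetD[OF E(3) that] unfolding UN_iff mem_ball by (simp add: dist_commute)
    then obtain c where c: "\<And>x. x \<in> K \<Longrightarrow> c x \<in> E \<and> dist x (c x) < r/3"
      by metis
    define F where "F = (\<lambda>xs. b (mset xs)) ` {xs. set xs \<subseteq> E \<and> length xs = n}"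
    have "finite F"
      unfolding F_def using finite_lists_length_eq[OF E(1)] by blast
    have near: "\<exists>z\<in>F. dist x z \<le> r/3" if x: "x \<in> Orb" for x
    proof -
      obtain \<phi> where \<phi>: "\<phi> \<in> G" "x = \<phi> p"
        using x by (auto simp: Orb_def)
      define M where "M = image_mset \<phi> (mset_set N)"
      have M: "size M = n" "set_mset M \<subseteq> K"
        using size N G(2)[OF \<phi>(1)] by (auto simp: M_def)
      define P where "P = image_mset (\<lambda>x. (x, c x)) M"
      have "dist (b (image_mset fst P)) (b (image_mset snd P)) \<le> r/3"
      proof (rule mean_dist_coupling)
        fix q assume "q \<in># P"
        then obtain y where "y \<in># M" "q = (y, c y)"
          by (auto simp: P_def)
        then show "dist (fst q) (snd q) \<le> r/3"
          using M(2) c[of y] by auto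
      qed (use n M in \<open>auto simp: P_def\<close>)
      moreover have "image_mset fst P = M" "image_mset snd P = image_mset c M"
        by (simp_all add: P_def multiset.map_comp o_def)
      moreover have "b (image_mset c M) \<in> F"
      proof -
        obtain xs where xs: "mset xs = image_mset c M"
          using ex_mset by blast
        have "set xs = c ` set_mset M"
          using xs by (metis set_mset_mset set_image_mset)
        moreover have "length xs = n"
          using xs M(1) by (metis size_mset size_image_mset)
        ultimately have "xs \<in> {xs. set xs \<subseteq> E \<and> length xs = n}"
          using M(2) c by auto
        then show ?thesis
          unfolding F_def using xs by (metis imageI)
      qed
      ultimately show ?thesis
        using p_image \<phi> M_def by metis
    qed
    have "closure Orb \<subseteq> (\<Union>z\<in>F. ball z r)"
    proof
      fix x assume "x \<in> closure Orb"
      then obtain x' where "x' \<in> Orb" "dist x' x < r/3"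
        using \<open>r > 0\<close> unfolding closure_approachable by (metis divide_pos_pos zero_less_numeral)
      moreover obtain z where "z \<in> F" "dist x' z \<le> r/3"
        using near \<open>x' \<in> Orb\<close> by blast
      ultimately have "dist z x < r"
        using dist_triangle[of z x x'] \<open>r > 0\<close> by (simp add: dist_commute)
      then show "x \<in> (\<Union>z\<in>F. ball z r)"
        using \<open>z \<in> F\<close> by auto
    qed
    then show "\<exists>k. finite k \<and> closure Orb \<subseteq> (\<Union>x\<in>k. ball x r)"
      using \<open>finite F\<close> by blast
  qed
  moreover have "closure Orb \<subseteq> closed_hull K"
    using Orb_hull closed_closed_hull by (rule closure_minimal)
  moreover have "closure Orb \<subseteq> closed_hull Orb"
    using closed_hull_superset closed_closed_hull by (rule closure_minimal)
  then have "dist x y \<le> e" if "x \<in> closure Orb" "y \<in> closure Orb" for x y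
    using that by (intro dist_closed_hull_le[OF Orb_dist]) blast+
  moreover
  have into: "\<phi> ` closure Orb \<subseteq> closure Orb" if "\<phi> \<in> G" for \<phi>
  proof -
    have "\<phi> ` Orb \<subseteq> Orb"
    proof
      fix x assume "x \<in> \<phi> ` Orb"
      then obtain \<psi> where \<psi>: "\<psi> \<in> G" "x = (\<phi> \<circ> \<psi>) p"
        by (auto simp: Orb_def)
      have "\<phi> \<circ> \<psi> \<in> G"
        using \<open>\<phi> \<in> G\<close> \<psi>(1) unfolding G_def by (rule setwise_stabiliser_comp)
      then show "x \<in> Orb"
        unfolding Orb_def \<psi>(2) by (rule imageI)
    qed
    then show ?thesis
      using symmetries_continuous[OF G(1)[OF that]] closure_subset
      by (intro image_closure_subset) auto
  qed
  have "\<phi> ` closure Orb = closure Orb" if "\<phi> \<in> G" for \<phi>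
  proof
    have "inv \<phi> \<in> G"
      using that unfolding G_def by (rule setwise_stabiliser_inv)
    then have "\<phi> ` (inv \<phi> ` closure Orb) \<subseteq> \<phi> ` closure Orb"
      by (intro image_mono into)
    then show "closure Orb \<subseteq> \<phi> ` closure Orb"
      using symmetries_bij[OF G(1)[OF that]] by (simp add: bij_is_surj image_f_inv_f)
  qed (rule into[OF that])
  with G(1) have "setwise_stabiliser \<sigma> K \<subseteq> setwise_stabiliser \<sigma> (closure Orb)"
    unfolding G_def setwise_stabiliser_def by blast
  moreover have "closure Orb \<noteq> {}"
    using p_Orb closure_subset by blast
  ultimately show ?thesis
    by blast
qed

text \<open>
  Invariance under the stabiliser of the original \<open>K\<close> is carried along the sequence by inclusions of
  stabilisers. A symmetry preserving all sets of the sequence preserves their hulls, and therefore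
  the only point that these have in common.
\<close>

lemma stabiliser_fixed_point:
  assumes mid: "midpoint_property \<sigma>" and K: "compact K" "K \<noteq> {}"
  shows "\<exists>x\<in>closed_hull K. \<forall>\<phi>\<in>setwise_stabiliser \<sigma> K. \<phi> x = x"
proof -
  define good where "good k L \<longleftrightarrow> compact L \<and> L \<noteq> {} \<and> setwise_stabiliser \<sigma> K \<subseteq> setwise_stabiliser \<sigma> L \<and>
      (k = 0 \<longrightarrow> L = K)" for k :: nat and L
  have "\<exists>L. \<forall>k. good k (L k) \<and>
      (L (Suc k) \<subseteq> closed_hull (L k) \<and> (\<forall>x\<in>L (Suc k). \<forall>y\<in>L (Suc k). dist x y \<le> 1 / Suc k))"
  proof (rule dependent_nat_choice)
    show "\<exists>L. good 0 L"
      using K by (auto simp: good_def)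
    fix L k assume L: "good k L"
    have "\<exists>L'. compact L' \<and> L' \<noteq> {} \<and> L' \<subseteq> closed_hull L \<and>
        (\<forall>x\<in>L'. \<forall>y\<in>L'. dist x y \<le> 1 / Suc k) \<and>
        setwise_stabiliser \<sigma> L \<subseteq> setwise_stabiliser \<sigma> L'"
      using L by (intro small_invariant_compactum[OF mid]) (simp_all add: good_def)
    then obtain L' where L': "compact L'" "L' \<noteq> {}" "L' \<subseteq> closed_hull L"
      "\<forall>x\<in>L'. \<forall>y\<in>L'. dist x y \<le> 1 / Suc k"
      "setwise_stabiliser \<sigma> L \<subseteq> setwise_stabiliser \<sigma> L'"
      by blast
    moreover have "good (Suc k) L'"
      using L L'(1,2,5) unfolding good_def by blast
    ultimately show "\<exists>L'. good (Suc k) L' \<and>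
        (L' \<subseteq> closed_hull L \<and> (\<forall>x\<in>L'. \<forall>y\<in>L'. dist x y \<le> 1 / Suc k))"
      by blast
  qed
  then obtain L where good: "\<And>k. good k (L k)" and step: "\<And>k. L (Suc k) \<subseteq> closed_hull (L k)"
    and small: "\<And>k x y. x \<in> L (Suc k) \<Longrightarrow> y \<in> L (Suc k) \<Longrightarrow> dist x y \<le> 1 / Suc k"
    by metis
  have "\<exists>a. (\<Inter>k. closed_hull (L k)) = {a}"
  proof (rule closed_hull_nest)
    show "L k \<noteq> {}" for k
      using good by (auto simp: good_def)
    show "L (Suc k) \<subseteq> closed_hull (L k)" for k
      by (rule step)
    fix e :: real assume "e > 0"
    then obtain k where "1 / Suc k < e"
      using nat_approx_posE by blast
    then have "dist x y \<le> e" if "x \<in> L (Suc k)" "y \<in> L (Suc k)" for x y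
      using small[OF that] by linarith
    then show "\<exists>k. \<forall>x\<in>L k. \<forall>y\<in>L k. dist x y \<le> e"
      by blast
  qed
  then obtain a where a: "(\<Inter>k. closed_hull (L k)) = {a}"
    by blast
  have "\<phi> a = a" if "\<phi> \<in> setwise_stabiliser \<sigma> K" for \<phi>
  proof -
    have "\<phi> a \<in> closed_hull (L k)" for k
    proof -
      have "\<phi> \<in> setwise_stabiliser \<sigma> (L k)"
        using good[of k] that unfolding good_def by blast
      then have "\<phi> ` closed_hull (L k) \<subseteq> closed_hull (L k)"
        using symmetry_closed_hull[of \<phi> "L k"] by (simp add: setwise_stabiliser_def)
      moreover have "a \<in> closed_hull (L k)"
        using a by blast
      ultimately show ?thesis
        by blast
    qed
    then show ?thesis
      using a by blast
  qed
  moreover have "a \<in> closed_hull (L 0)"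
    using a by blast
  moreover have "L 0 = K"
    using good[of 0] by (simp add: good_def)
  ultimately show ?thesis
    by blast
qed

end

theorem theorem1p1:
  fixes \<sigma> :: "'a::complete_space \<Rightarrow> 'a \<Rightarrow> real \<Rightarrow> 'a"
    and S :: "('a \<Rightarrow> 'a) set"
    and K :: "'a set"
  assumes "conical_geodesic_bicombing \<sigma>"
    and "midpoint_property \<sigma>"
    and "equivariant_subsemigroup \<sigma> S"
    and "K \<noteq> {}"
    and "compact K"
    and "\<And>s. s \<in> S \<Longrightarrow> s ` K = K"
  shows "\<exists>x \<in> closure (sigma_convex_hull \<sigma> K). \<forall>s\<in>S. s x = x"
proof -
  interpret conical_bicombing \<sigma>
    using assms(1) by unfold_locales
  have "S \<subseteq> setwise_stabiliser \<sigma> K"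
    using assms(3,6)
    by (auto simp: equivariant_subsemigroup_def isometry_subsemigroup_def
        setwise_stabiliser_def symmetries_def)
  then show ?thesis
    using stabiliser_fixed_point[OF assms(2,5,4)] closed_hull_subset[of K] by blast
qed

end
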